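(* Let $\Omega=\{1,\dots,n\}$. The following hold for set functions $f:2^\Omega\to\mathbb{R}$: (a) Any set function of degree $0$ or $1$ is $0$-sos-submodular. (b) Any submodular set function of degree $2$ is $0$-sos-submodular. (c) Any submodular set function of degree $3$ is $1$-sos-submodular.
   Context: A set function $f:2^\Omega\to\mathbb{R}$ is submodular if $f(S)+f(T)\ge f(S\cup T)+f(S\cap T)$ for all $S,T\subseteq\Omega$. The multilinear extension (MLE) of $f$ is the unique multilinear polynomial $F\in\mathbb{R}[x_1,\dots,x_n]$ (every variable appears with power at most $1$ in every monomial) with $F(1_S)=f(S)$ for all $S\subseteq\Omega$, where $1_S\in\{0,1\}^n$ is the indicator vector of $S$. The degree of $f$ is the degree of $F$. For an ideal $I$ of a real polynomial ring, a polynomial $p$ is $t$-sos modulo $I$ if there are finitely many polynomials $q_1,\dots,q_m$ in that ring, each of degree at most $t$, with $p-\sum_{r=1}^m q_r^2\in I$. For $i\ne j$, $x_{-i,j}$ denotes the variables $x_1,\dots,x_n$ with $x_i,x_j$ removed, and $I_2[x_{-i,j}]=\langle x_k^2-x_k : k\neq i,j\rangle\subseteq\mathbb{R}[x_{-i,j}]$. The set function $f$ with MLE $F$ is $t$-sos-submodular ($t\in\{0,1,2,\dots\}$) if for all $i\neq j$ the polynomial $-\frac{\partial^2F(x)}{\partial x_i\partial x_j}$ (which does not involve $x_i,x_j$) is $t$-sos modulo $I_2[x_{-i,j}]$. *)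

theory Defs
  imports "HOL-Library.Poly_Mapping" "HOL-Library.Indicator_Function" "HOL-Algebra.Ideal"
begin

section \<open>Real polynomials in variables indexed by natural numbers\<close>

text \<open>
  A monomial is the finitely supported map from variable indices to exponents, and a polynomial
  is the finitely supported map from monomials to coefficients. The ring operations are those of
  \<^theory>\<open>HOL-Library.Poly_Mapping\<close>. The polynomial ring in a set \<open>V\<close> of variables is the
  subring \<open>mpolys V\<close>.
\<close>

type_synonym monom = "nat \<Rightarrow>\<^sub>0 nat"
type_synonym mpoly = "monom \<Rightarrow>\<^sub>0 real"

definition mvar :: "nat \<Rightarrow> mpoly" where
  "mvar i = Poly_Mapping.single (Poly_Mapping.single i 1) 1"

definition mpolys :: "nat set \<Rightarrow> mpoly set" where
  "mpolys V = {p. \<forall>m\<in>Poly_Mapping.keys p. Poly_Mapping.keys m \<subseteq> V}"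

definition mpoly_eval :: "mpoly \<Rightarrow> (nat \<Rightarrow> real) \<Rightarrow> real" where
  "mpoly_eval p x =
     (\<Sum>m\<in>Poly_Mapping.keys p.
        Poly_Mapping.lookup p m * (\<Prod>k\<in>Poly_Mapping.keys m. x k ^ Poly_Mapping.lookup m k))"

definition monom_degree :: "monom \<Rightarrow> nat" where
  "monom_degree m = (\<Sum>k\<in>Poly_Mapping.keys m. Poly_Mapping.lookup m k)"

text \<open>The total degree; the zero polynomial gets degree 0.\<close>

definition mpoly_degree :: "mpoly \<Rightarrow> nat" where
  "mpoly_degree p = Max (insert 0 (monom_degree ` Poly_Mapping.keys p))"

text \<open>
  If \<open>x\<^sub>i\<close> does not occur in \<open>m\<close>, the truncated exponent of the corresponding summand is
  immaterial, because its coefficient is 0.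
\<close>

definition mpoly_partial :: "nat \<Rightarrow> mpoly \<Rightarrow> mpoly" where
  "mpoly_partial i p =
     (\<Sum>m\<in>Poly_Mapping.keys p.
        Poly_Mapping.single (m - Poly_Mapping.single i 1)
          (Poly_Mapping.lookup p m * real (Poly_Mapping.lookup m i)))"

definition multilinear_poly :: "mpoly \<Rightarrow> bool" where
  "multilinear_poly p \<longleftrightarrow> (\<forall>m\<in>Poly_Mapping.keys p. \<forall>k. Poly_Mapping.lookup m k \<le> 1)"

definition mpoly_ring :: "nat set \<Rightarrow> mpoly ring" where
  "mpoly_ring V = \<lparr>carrier = mpolys V, mult = (*), one = 1, zero = 0, add = (+)\<rparr>"

lemma cring_mpoly_ring: "cring (mpoly_ring V)"
proof -
  have add: "p + q \<in> mpolys V" if "p \<in> mpolys V" "q \<in> mpolys V" for p q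
    using that Poly_Mapping.keys_add[of p q] unfolding mpolys_def by blast
  have uminus: "- p \<in> mpolys V" if "p \<in> mpolys V" for p
    using that by (simp add: mpolys_def in_keys_iff)
  have mult: "p * q \<in> mpolys V" if p: "p \<in> mpolys V" and q: "q \<in> mpolys V" for p q
    unfolding mpolys_def
  proof (intro CollectI ballI)
    fix m assume "m \<in> Poly_Mapping.keys (p * q)"
    then obtain a b where "a \<in> Poly_Mapping.keys p" "b \<in> Poly_Mapping.keys q" "m = a + b"
      using keys_mult[of p q] by blast
    then show "Poly_Mapping.keys m \<subseteq> V"
      using p q Poly_Mapping.keys_add[of a b] unfolding mpolys_def by blast
  qed
  have "0 \<in> mpolys V" "1 \<in> mpolys V"
    by (auto simp: mpolys_def)
  then show ?thesis
    by (intro cringI abelian_groupI comm_monoidI)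
      (auto simp: mpoly_ring_def add mult algebra_simps intro!: bexI[of _ "- _"] uminus)
qed

section \<open>Set functions and their multilinear extensions\<close>

text \<open>
  A set function on \<open>{1..n}\<close> is a map \<open>f :: nat set \<Rightarrow> real\<close> of which only the values on subsets
  of \<open>{1..n}\<close> are used.
\<close>

definition submodular :: "nat \<Rightarrow> (nat set \<Rightarrow> real) \<Rightarrow> bool" where
  "submodular n f \<longleftrightarrow>
     (\<forall>S T. S \<subseteq> {1..n} \<longrightarrow> T \<subseteq> {1..n} \<longrightarrow> f S + f T \<ge> f (S \<union> T) + f (S \<inter> T))"

definition is_mle :: "nat \<Rightarrow> (nat set \<Rightarrow> real) \<Rightarrow> mpoly \<Rightarrow> bool" where
  "is_mle n f F \<longleftrightarrow>
     F \<in> mpolys {1..n} \<and> multilinear_poly F \<and>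
     (\<forall>S\<subseteq>{1..n}. mpoly_eval F (indicator S) = f S)"

definition mle :: "nat \<Rightarrow> (nat set \<Rightarrow> real) \<Rightarrow> mpoly" where
  "mle n f = (THE F. is_mle n f F)"

lemma mpoly_eval_indicator:
  "mpoly_eval p (indicator S) =
     (\<Sum>m | m \<in> Poly_Mapping.keys p \<and> Poly_Mapping.keys m \<subseteq> S. Poly_Mapping.lookup p m)"
proof -
  have mono: "(\<Prod>k\<in>Poly_Mapping.keys m. (indicator S k :: real) ^ Poly_Mapping.lookup m k) =
      (if Poly_Mapping.keys m \<subseteq> S then 1 else 0)" for m :: monom
  proof (cases "Poly_Mapping.keys m \<subseteq> S")
    case True
    then show ?thesis by (auto intro!: prod.neutral simp: indicator_def)
  next
    case False
    then obtain k where "k \<in> Poly_Mapping.keys m" "k \<notin> S" by blast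
    then show ?thesis using False
      by (auto simp: in_keys_iff intro!: prod_zero bexI[of _ k])
  qed
  show ?thesis
    unfolding mpoly_eval_def mono
    by (simp add: sum.inter_filter if_distrib cong: if_cong)
qed

lemma monom_eqI_multilinear:
  fixes m m' :: monom
  assumes "\<And>k. Poly_Mapping.lookup m k \<le> 1" "\<And>k. Poly_Mapping.lookup m' k \<le> 1"
    and "Poly_Mapping.keys m = Poly_Mapping.keys m'"
  shows "m = m'"
proof (rule poly_mapping_eqI)
  fix k
  have "Poly_Mapping.lookup m k = 0 \<longleftrightarrow> Poly_Mapping.lookup m' k = 0"
    using assms(3) by (metis in_keys_iff)
  then show "Poly_Mapping.lookup m k = Poly_Mapping.lookup m' k"
    using assms(1)[of k] assms(2)[of k] by linarith
qed

lemma is_mle_unique: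
  assumes "is_mle n f F" "is_mle n f G"
  shows "F = G"
proof (rule poly_mapping_eqI)
  let ?l = "Poly_Mapping.lookup"
  let ?K = "Poly_Mapping.keys F \<union> Poly_Mapping.keys G"
  have lin: "?l m k \<le> 1" if "m \<in> ?K" for m k
    using that assms by (auto simp: is_mle_def multilinear_poly_def)
  have sub: "Poly_Mapping.keys m \<subseteq> {1..n}" if "m \<in> ?K" for m
    using that assms by (auto simp: is_mle_def mpolys_def)
  have ext: "mpoly_eval H (indicator S) = (\<Sum>m | m \<in> ?K \<and> Poly_Mapping.keys m \<subseteq> S. ?l H m)"
    if "H = F \<or> H = G" for H S
    unfolding mpoly_eval_indicator
  proof (rule sum.mono_neutral_left)
    show "finite {m. m \<in> ?K \<and> Poly_Mapping.keys m \<subseteq> S}"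
      by (rule finite_subset[of _ ?K]) auto
  qed (use that in \<open>auto simp: in_keys_iff\<close>)
  have eq: "?l F m = ?l G m" if "m \<in> ?K" for m
    using that
  proof (induction "card (Poly_Mapping.keys m)" arbitrary: m rule: less_induct)
    case less
    let ?A = "{m' \<in> ?K. Poly_Mapping.keys m' \<subseteq> Poly_Mapping.keys m}"
    have fin: "finite ?A" by simp
    have mA: "m \<in> ?A" using less.prems by simp
    have "?l F m' = ?l G m'" if "m' \<in> ?A - {m}" for m'
    proof (rule less.hyps)
      have "Poly_Mapping.keys m' \<noteq> Poly_Mapping.keys m"
        using that less.prems lin monom_eqI_multilinear[of m' m] by blast
      then show "card (Poly_Mapping.keys m') < card (Poly_Mapping.keys m)"
        using that by (intro psubset_card_mono) auto
    qed (use that in blast)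
    then have "sum (?l F) (?A - {m}) = sum (?l G) (?A - {m})"
      by (rule sum.cong[OF refl])
    moreover have "sum (?l F) ?A = sum (?l G) ?A"
      using assms sub[OF less.prems] ext[of F "Poly_Mapping.keys m"] ext[of G "Poly_Mapping.keys m"]
      by (simp add: is_mle_def)
    ultimately show ?case
      using sum.remove[OF fin mA, of "?l F"] sum.remove[OF fin mA, of "?l G"] by linarith
  qed
  show "?l F m = ?l G m" for m
    using eq[of m] by (cases "m \<in> ?K") (auto simp: in_keys_iff)
qed

lemma is_mle_exists: "\<exists>F. is_mle n f F"
proof -
  define xm :: "nat set \<Rightarrow> monom" where "xm T = (\<Sum>i\<in>T. Poly_Mapping.single i 1)" for T
  define c where "c T = (-1) ^ card T * (\<Sum>S\<in>Pow T. (-1) ^ card S * f S)" for T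
  define F :: mpoly where "F = (\<Sum>T\<in>Pow {1..n}. Poly_Mapping.single (xm T) (c T))"
  have lxm: "Poly_Mapping.lookup (xm T) k = (if k \<in> T then 1 else 0)" if "T \<subseteq> {1..n}" for T k
    using finite_subset[OF that] by (simp add: xm_def lookup_sum lookup_single when_def)
  then have kxm: "Poly_Mapping.keys (xm T) = T" if "T \<subseteq> {1..n}" for T
    using that by (auto simp: in_keys_iff split: if_splits)
  have inj: "inj_on xm (Pow {1..n})"
  proof (rule inj_onI)
    fix T T' assume TT: "T \<in> Pow {1..n}" "T' \<in> Pow {1..n}" and eq: "xm T = xm T'"
    have "Poly_Mapping.keys (xm T) = Poly_Mapping.keys (xm T')" by (simp only: eq)
    then show "T = T'" unfolding kxm[OF PowD[OF TT(1)]] kxm[OF PowD[OF TT(2)]] .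
  qed
  have lF: "Poly_Mapping.lookup F (xm T) = c T" if "T \<subseteq> {1..n}" for T
  proof -
    have "Poly_Mapping.lookup F (xm T) = (\<Sum>T'\<in>Pow {1..n}. if T' = T then c T' else 0)"
      unfolding F_def lookup_sum lookup_single
      by (intro sum.cong refl) (use that in \<open>simp add: when_def inj_on_eq_iff[OF inj]\<close>)
    then show ?thesis using that by simp
  qed
  have kF: "Poly_Mapping.keys F \<subseteq> xm ` Pow {1..n}"
  proof
    fix m assume "m \<in> Poly_Mapping.keys F"
    then have "(\<Sum>T\<in>Pow {1..n}. Poly_Mapping.lookup (Poly_Mapping.single (xm T) (c T)) m) \<noteq> 0"
      by (simp add: in_keys_iff F_def lookup_sum)
    then obtain T where "T \<in> Pow {1..n}" "Poly_Mapping.lookup (Poly_Mapping.single (xm T) (c T)) m \<noteq> 0"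
      by (rule sum.not_neutral_contains_not_neutral)
    then show "m \<in> xm ` Pow {1..n}"
      by (auto simp: lookup_single when_def split: if_splits)
  qed
  have "mpoly_eval F (indicator S) = f S" if S: "S \<subseteq> {1..n}" for S
  proof -
    have fS: "finite S" using S finite_subset by blast
    have "mpoly_eval F (indicator S) = (\<Sum>m\<in>xm ` Pow S. Poly_Mapping.lookup F m)"
      unfolding mpoly_eval_indicator
    proof (rule sum.mono_neutral_left)
      show "finite (xm ` Pow S)" using fS by simp
      show "{m \<in> Poly_Mapping.keys F. Poly_Mapping.keys m \<subseteq> S} \<subseteq> xm ` Pow S"
      proof
        fix m assume m: "m \<in> {m \<in> Poly_Mapping.keys F. Poly_Mapping.keys m \<subseteq> S}"
        then obtain T where "T \<subseteq> {1..n}" "m = xm T" using kF by blast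
        then show "m \<in> xm ` Pow S" using m kxm[of T] by blast
      qed
      show "\<forall>m\<in>xm ` Pow S - {m \<in> Poly_Mapping.keys F. Poly_Mapping.keys m \<subseteq> S}.
          Poly_Mapping.lookup F m = 0"
      proof
        fix m assume m: "m \<in> xm ` Pow S - {m \<in> Poly_Mapping.keys F. Poly_Mapping.keys m \<subseteq> S}"
        then obtain T where T: "T \<subseteq> S" "m = xm T" by blast
        then have "Poly_Mapping.keys m = T" using kxm[of T] S by blast
        then show "Poly_Mapping.lookup F m = 0" using m T by (simp add: in_keys_iff)
      qed
    qed
    also have "\<dots> = (\<Sum>T\<in>Pow S. c T)"
    proof (subst sum.reindex)
      show "inj_on xm (Pow S)" using S by (intro inj_on_subset[OF inj]) auto
      show "sum (Poly_Mapping.lookup F \<circ> xm) (Pow S) = sum c (Pow S)"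
        using S lF by (intro sum.cong) auto
    qed
    also have "\<dots> = f S"
      unfolding c_def by (rule inclusion_exclusion_symmetric[OF _ fS, symmetric]) simp
    finally show ?thesis .
  qed
  moreover have "F \<in> mpolys {1..n}"
    unfolding mpolys_def
  proof (intro CollectI ballI)
    fix m assume "m \<in> Poly_Mapping.keys F"
    then obtain T where "T \<subseteq> {1..n}" "m = xm T" using kF by blast
    then show "Poly_Mapping.keys m \<subseteq> {1..n}" using kxm[of T] by blast
  qed
  moreover have "multilinear_poly F"
    unfolding multilinear_poly_def
  proof (intro ballI allI)
    fix m k assume "m \<in> Poly_Mapping.keys F"
    then obtain T where "T \<subseteq> {1..n}" "m = xm T" using kF by blast
    then show "Poly_Mapping.lookup m k \<le> 1" using lxm[of T k] by simp
  qed
  ultimately show ?thesis by (auto simp: is_mle_def)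
qed

lemma is_mle_mle: "is_mle n f (mle n f)"
proof -
  obtain F where F: "is_mle n f F" using is_mle_exists by blast
  show ?thesis unfolding mle_def by (rule theI[where P = "is_mle n f", OF F]) (rule is_mle_unique[OF _ F])
qed

definition set_fun_degree :: "nat \<Rightarrow> (nat set \<Rightarrow> real) \<Rightarrow> nat" where
  "set_fun_degree n f = mpoly_degree (mle n f)"

section \<open>Sums of squares modulo an ideal\<close>

text \<open>
  Here \<open>I\<close> is meant to be an ideal of the ring \<open>mpoly_ring V\<close>.
\<close>

definition sos_mod :: "nat set \<Rightarrow> mpoly set \<Rightarrow> nat \<Rightarrow> mpoly \<Rightarrow> bool" where
  "sos_mod V I t p \<longleftrightarrow>
     (\<exists>qs. (\<forall>q\<in>set qs. q \<in> mpolys V \<and> mpoly_degree q \<le> t) \<and> p - (\<Sum>q\<leftarrow>qs. q\<^sup>2) \<in> I)"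

definition boolean_ideal :: "nat set \<Rightarrow> mpoly set" where
  "boolean_ideal V = Idl\<^bsub>mpoly_ring V\<^esub> {(mvar k)\<^sup>2 - mvar k | k. k \<in> V}"

definition sos_submodular :: "nat \<Rightarrow> nat \<Rightarrow> (nat set \<Rightarrow> real) \<Rightarrow> bool" where
  "sos_submodular n t f \<longleftrightarrow>
     (\<forall>i\<in>{1..n}. \<forall>j\<in>{1..n}. i \<noteq> j \<longrightarrow>
        sos_mod ({1..n} - {i, j}) (boolean_ideal ({1..n} - {i, j})) t
          (- mpoly_partial i (mpoly_partial j (mle n f))))"

end

theory Submission
  imports Defs
begin

text \<open>
  Write \<open>F\<close> for the multilinear extension of \<open>f\<close>. Differentiating a multilinear polynomial in
  \<open>x\<^sub>i\<close> is the same as taking the difference of its values at \<open>x\<^sub>i = 1\<close> and \<open>x\<^sub>i = 0\<close>. The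
  value of \<open>G = - \<partial>\<^sub>i \<partial>\<^sub>j F\<close>, \<open>i \<noteq> j\<close>, at the indicator vector of a set \<open>S\<close> without \<open>i\<close> and
  \<open>j\<close> is therefore
  \<open>f (S \<union> {i}) + f (S \<union> {j}) - f (S \<union> {i, j}) - f S\<close>, and submodularity makes \<open>G\<close> nonnegative at
  every 0/1 point. Moreover the degree of \<open>G\<close> is at least two below that of \<open>F\<close>. So in degree at
  most 1 the polynomial \<open>G\<close> vanishes, and in degree 2 or 3 it is an affine polynomial
  \<open>c\<^sub>0 + \<Sum>\<^sub>k c\<^sub>k x\<^sub>k\<close> that is nonnegative on the cube.

  The heart of the matter is that such an affine polynomial is a sum of squares of affine
  polynomials modulo the relations \<open>x\<^sub>k\<^sup>2 = x\<^sub>k\<close>. It attains its minimum over the cube at the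
  indicator vector of \<open>{k. c\<^sub>k < 0}\<close>, and the minimum is \<open>m = c\<^sub>0 - \<Sum>\<^sub>k max 0 (- c\<^sub>k) \<ge> 0\<close>.
  After splitting off \<open>m = (\<surd>m)\<^sup>2\<close> there remains a sum of terms \<open>max 0 (- c\<^sub>k) + c\<^sub>k x\<^sub>k\<close>, each
  depending on one variable and nonnegative at 0 and at 1. As a function on \<open>{0, 1}\<close>, such a term
  is the square of the affine function that interpolates the square roots of its two values. If
  all \<open>c\<^sub>k\<close> vanish, only the constant square remains, and this gives the sharper bound on the
  degree of the squares for set functions of degree 2
  (\<open>sos_mod_boolean_affine_if_nonneg\<close>).
\<close>

section \<open>Degree and membership in a polynomial ring\<close>

definition mconst :: "real \<Rightarrow> mpoly" where
  "mconst c = Poly_Mapping.single 0 c"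

lemma mconst_add: "mconst (a + b) = mconst a + mconst b"
  by (simp add: mconst_def single_add)

lemma mconst_diff: "mconst (a - b) = mconst a - mconst b"
  by (simp add: mconst_def single_diff)

lemma mconst_mult: "mconst (a * b) = mconst a * mconst b"
  by (simp add: mconst_def mult_single)

lemma mconst_sum: "mconst (\<Sum>k\<in>A. g k) = (\<Sum>k\<in>A. mconst (g k))"
  by (induction A rule: infinite_finite_induct) (simp_all add: mconst_add, simp_all add: mconst_def)

lemma mconst_times_mvar: "mconst c * mvar k = Poly_Mapping.single (Poly_Mapping.single k 1) c"
  by (simp add: mconst_def mvar_def mult_single)

lemma mpoly_degree_le_iff:
  "mpoly_degree p \<le> t \<longleftrightarrow> (\<forall>m\<in>Poly_Mapping.keys p. monom_degree m \<le> t)"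
  by (simp add: mpoly_degree_def)

lemma monom_degree_0 [simp]: "monom_degree 0 = 0"
  by (simp add: monom_degree_def)

lemma monom_degree_single [simp]: "monom_degree (Poly_Mapping.single k e) = e"
  by (cases "e = 0") (simp_all add: monom_degree_def)

lemma monom_degree_add_single:
  "monom_degree (m + Poly_Mapping.single k e) = monom_degree m + e"
proof -
  let ?e = "Poly_Mapping.single k e"
  have fin: "finite (insert k (Poly_Mapping.keys m))" by simp
  have sup: "monom_degree m' = (\<Sum>l\<in>insert k (Poly_Mapping.keys m). Poly_Mapping.lookup m' l)"
    if "Poly_Mapping.keys m' \<subseteq> insert k (Poly_Mapping.keys m)" for m'
    unfolding monom_degree_def
    by (rule sum.mono_neutral_left[OF fin that]) (simp add: in_keys_iff)
  have "Poly_Mapping.keys (m + ?e) \<subseteq> insert k (Poly_Mapping.keys m)"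
    using Poly_Mapping.keys_add[of m ?e] by (auto split: if_splits)
  moreover have "Poly_Mapping.keys ?e \<subseteq> insert k (Poly_Mapping.keys m)"
    by (auto split: if_splits)
  ultimately have "monom_degree (m + ?e) = monom_degree m + monom_degree ?e"
    using sup[of "m + ?e"] sup[of ?e] sup[of m] by (simp add: lookup_add sum.distrib subset_insertI)
  then show ?thesis by simp
qed

text \<open>
  A monomial of degree at most 1 is \<open>1\<close> or a single variable. This is what turns a degree bound
  into an explicit affine normal form.
\<close>

lemma monom_degree_le_1E:
  assumes "monom_degree m \<le> 1"
  obtains "m = 0" | k where "m = Poly_Mapping.single k 1"
proof (cases "m = 0")
  case False
  then obtain k where k: "k \<in> Poly_Mapping.keys m"
    by (metis keys_eq_empty all_not_in_conv)
  then have "m = (m - Poly_Mapping.single k 1) + Poly_Mapping.single k 1"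
    by (intro poly_mapping_eqI)
      (auto simp: lookup_add lookup_minus lookup_single when_def in_keys_iff)
  then obtain m' where m': "m = m' + Poly_Mapping.single k 1" by blast
  then have "monom_degree m' = 0"
    using assms by (simp add: monom_degree_add_single)
  then have "m' = 0"
    by (intro poly_mapping_eqI) (auto simp: monom_degree_def in_keys_iff)
  then show ?thesis using m' that(2) by simp
qed (use that in blast)

lemma single_1_neq_0: "Poly_Mapping.single k (1::nat) \<noteq> 0"
  by (simp flip: keys_eq_empty)

lemma single_1_eq_iff: "Poly_Mapping.single k (1::nat) = Poly_Mapping.single l 1 \<longleftrightarrow> k = l"
  by (metis keys_single one_neq_zero singleton_inject)

lemma mpoly_ring_simps:
  "carrier (mpoly_ring V) = mpolys V" "mult (mpoly_ring V) = (*)" "add (mpoly_ring V) = (+)"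
  "zero (mpoly_ring V) = 0"
  by (simp_all add: mpoly_ring_def)

lemma mconst_in_mpolys: "mconst c \<in> mpolys V"
  by (auto simp: mpolys_def mconst_def split: if_splits)

lemma mvar_in_mpolys: "k \<in> V \<Longrightarrow> mvar k \<in> mpolys V"
  by (auto simp: mpolys_def mvar_def)

lemma mpolys_add: "p \<in> mpolys V \<Longrightarrow> q \<in> mpolys V \<Longrightarrow> p + q \<in> mpolys V"
  using Poly_Mapping.keys_add[of p q] unfolding mpolys_def by blast

lemma mpolys_uminus: "p \<in> mpolys V \<Longrightarrow> - p \<in> mpolys V"
  by (simp add: mpolys_def)

lemma mpolys_mult: "p \<in> mpolys V \<Longrightarrow> q \<in> mpolys V \<Longrightarrow> p * q \<in> mpolys V"
  using monoid.m_closed[OF ring.is_monoid[OF cring.axioms(1)[OF cring_mpoly_ring]], of p V q]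
  by (simp add: mpoly_ring_simps)

section \<open>The Boolean ideal and the square of an affine polynomial\<close>

lemma boolean_generators_in_mpolys:
  "{(mvar k)\<^sup>2 - mvar k | k. k \<in> V} \<subseteq> carrier (mpoly_ring V)"
proof -
  have "(mvar k)\<^sup>2 - mvar k \<in> mpolys V" if "k \<in> V" for k
    using that mpolys_add[of "mvar k * mvar k" V "- mvar k"]
    by (simp add: power2_eq_square mvar_in_mpolys mpolys_mult mpolys_uminus)
  then show ?thesis by (auto simp: mpoly_ring_simps)
qed

lemma ideal_boolean_ideal: "ideal (boolean_ideal V) (mpoly_ring V)"
  unfolding boolean_ideal_def
  by (rule ring.genideal_ideal[OF cring.axioms(1)[OF cring_mpoly_ring] boolean_generators_in_mpolys])

lemma boolean_ideal_0: "0 \<in> boolean_ideal V"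
  using additive_subgroup.zero_closed[OF ideal.axioms(1)[OF ideal_boolean_ideal[of V]]]
  by (simp add: mpoly_ring_simps)

lemma boolean_ideal_sum:
  "(\<And>k. k \<in> A \<Longrightarrow> g k \<in> boolean_ideal V) \<Longrightarrow> (\<Sum>k\<in>A. g k) \<in> boolean_ideal V"
proof (induction A rule: infinite_finite_induct)
  case (insert a A)
  then show ?case
    using additive_subgroup.a_closed[OF ideal.axioms(1)[OF ideal_boolean_ideal[of V]]]
    by (simp add: mpoly_ring_simps)
qed (simp_all add: boolean_ideal_0)

lemma boolean_ideal_multiple:
  assumes "k \<in> V" "p \<in> mpolys V"
  shows "p * ((mvar k)\<^sup>2 - mvar k) \<in> boolean_ideal V"
proof -
  have "(mvar k)\<^sup>2 - mvar k \<in> boolean_ideal V"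
    using ring.genideal_self[OF cring.axioms(1)[OF cring_mpoly_ring] boolean_generators_in_mpolys]
      assms(1) unfolding boolean_ideal_def by blast
  then show ?thesis
    using ideal.I_l_closed[OF ideal_boolean_ideal] assms(2) by (simp add: mpoly_ring_simps)
qed

text \<open>
  Modulo \<open>x\<^sub>k\<^sup>2 = x\<^sub>k\<close>, the square of the affine polynomial in \<open>x\<^sub>k\<close> with values \<open>a\<close> at 0 and \<open>b\<close>
  at 1 is the affine polynomial with values \<open>a\<^sup>2\<close> and \<open>b\<^sup>2\<close>.
\<close>

lemma affine_square_boolean_ideal:
  assumes "k \<in> V"
  shows "(mconst (a\<^sup>2) + mconst (b\<^sup>2 - a\<^sup>2) * mvar k) - (mconst a + mconst (b - a) * mvar k)\<^sup>2
    \<in> boolean_ideal V"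
proof -
  have "(mconst (a\<^sup>2) + mconst (b\<^sup>2 - a\<^sup>2) * mvar k) - (mconst a + mconst (b - a) * mvar k)\<^sup>2
      = - mconst ((b - a)\<^sup>2) * ((mvar k)\<^sup>2 - mvar k)"
    unfolding power2_eq_square mconst_diff mconst_mult by (simp add: algebra_simps)
  then show ?thesis
    using boolean_ideal_multiple[OF assms mpolys_uminus[OF mconst_in_mpolys]] by simp
qed

section \<open>Affine polynomials that are nonnegative on the cube\<close>

lemma mpoly_affine_form:
  assumes "p \<in> mpolys V" "mpoly_degree p \<le> 1" "finite V"
  defines "c \<equiv> \<lambda>k. Poly_Mapping.lookup p (Poly_Mapping.single k 1)"
  shows "p = mconst (Poly_Mapping.lookup p 0) + (\<Sum>k\<in>V. mconst (c k) * mvar k)"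
proof (rule poly_mapping_eqI)
  fix m :: monom
  have "Poly_Mapping.lookup p m = (Poly_Mapping.lookup p 0 when 0 = m)
      + (\<Sum>k\<in>V. c k when Poly_Mapping.single k 1 = m)"
  proof (cases "monom_degree m \<le> 1")
    case True
    then show ?thesis
    proof (cases rule: monom_degree_le_1E)
      case 1
      then have "(\<Sum>k\<in>V. c k when Poly_Mapping.single k 1 = m) = 0"
        by (simp add: when_def single_1_neq_0 del: One_nat_def)
      then show ?thesis using 1 by simp
    next
      case (2 k)
      have "c k = 0" if "k \<notin> V"
      proof -
        have "Poly_Mapping.single k 1 \<notin> Poly_Mapping.keys p"
          using that assms(1) unfolding mpolys_def by force
        then show ?thesis by (simp add: c_def in_keys_iff)
      qed
      moreover have "(\<Sum>l\<in>V. c l when Poly_Mapping.single l 1 = m) = (\<Sum>l\<in>V. if l = k then c l else 0)"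
        unfolding 2 single_1_eq_iff by (simp only: when_def)
      moreover have "(Poly_Mapping.lookup p 0 when 0 = m) = 0"
        by (auto simp: 2 when_def single_1_neq_0[symmetric] simp del: One_nat_def)
      ultimately show ?thesis
        using 2 assms(3) by (simp add: c_def)
    qed
  next
    case False
    then have "m \<notin> Poly_Mapping.keys p"
      using assms(2) by (auto simp: mpoly_degree_le_iff)
    moreover have "m \<noteq> 0" "\<And>k. Poly_Mapping.single k 1 \<noteq> m"
      using False by auto
    ultimately show ?thesis by (simp add: when_def in_keys_iff)
  qed
  then show "Poly_Mapping.lookup p m
      = Poly_Mapping.lookup (mconst (Poly_Mapping.lookup p 0) + (\<Sum>k\<in>V. mconst (c k) * mvar k)) m"
    unfolding mconst_times_mvar by (simp add: lookup_add lookup_sum lookup_single mconst_def)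
qed

lemma mpoly_eval_indicator_affine:
  assumes "mpoly_degree p \<le> 1" "finite S"
  shows "mpoly_eval p (indicator S)
    = Poly_Mapping.lookup p 0 + (\<Sum>k\<in>S. Poly_Mapping.lookup p (Poly_Mapping.single k 1))"
proof -
  let ?e = "\<lambda>k::nat. Poly_Mapping.single k (1::nat)"
  have inj: "inj_on ?e S"
    by (intro inj_onI) (simp only: single_1_eq_iff)
  have ne: "0 \<notin> ?e ` S"
    using single_1_neq_0 by (metis imageE)
  have "mpoly_eval p (indicator S) = sum (Poly_Mapping.lookup p) (insert 0 (?e ` S))"
    unfolding mpoly_eval_indicator
  proof (rule sum.mono_neutral_left)
    show "{m \<in> Poly_Mapping.keys p. Poly_Mapping.keys m \<subseteq> S} \<subseteq> insert 0 (?e ` S)"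
    proof
      fix m assume m: "m \<in> {m \<in> Poly_Mapping.keys p. Poly_Mapping.keys m \<subseteq> S}"
      then have "monom_degree m \<le> 1"
        using assms(1) by (simp add: mpoly_degree_le_iff)
      then show "m \<in> insert 0 (?e ` S)"
        by (cases rule: monom_degree_le_1E) (use m in auto)
    qed
  qed (use assms(2) in \<open>auto simp: in_keys_iff\<close>)
  also have "\<dots> = Poly_Mapping.lookup p 0 + (\<Sum>k\<in>S. Poly_Mapping.lookup p (?e k))"
    using ne assms(2) by (simp add: sum.reindex[OF inj] del: One_nat_def)
  finally show ?thesis .
qed

lemma mpoly_degree_affine_le:
  assumes "b \<noteq> 0 \<Longrightarrow> 1 \<le> t"
  shows "mpoly_degree (mconst a + mconst b * mvar k) \<le> t"
  unfolding mpoly_degree_le_iff mconst_times_mvar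
  unfolding mconst_def
proof
  let ?A = "Poly_Mapping.single 0 a :: mpoly"
  let ?B = "Poly_Mapping.single (Poly_Mapping.single k 1) b :: mpoly"
  fix m assume "m \<in> Poly_Mapping.keys (?A + ?B)"
  then have "m \<in> Poly_Mapping.keys ?A \<union> Poly_Mapping.keys ?B"
    by (rule subsetD[OF Poly_Mapping.keys_add])
  then have "m = 0 \<or> m = Poly_Mapping.single k 1 \<and> b \<noteq> 0"
    by (auto simp del: One_nat_def split: if_splits)
  then show "monom_degree m \<le> t" using assms by auto
qed

text \<open>
  The minimum over the cube is split off as one constant square; each variable contributes the
  square of the interpolant of \<open>\<surd>(max 0 (- c\<^sub>k))\<close> and \<open>\<surd>(max 0 c\<^sub>k)\<close>. This interpolant is zero when
  \<open>c\<^sub>k = 0\<close>, so the squared polynomials never have a larger degree than \<open>p\<close> itself; hence the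
  degree of \<open>p\<close>, rather than 1, as the bound.
\<close>

lemma sos_mod_boolean_affine_if_nonneg:
  assumes "p \<in> mpolys V" "mpoly_degree p \<le> 1" "finite V"
    and nonneg: "\<And>S. S \<subseteq> V \<Longrightarrow> 0 \<le> mpoly_eval p (indicator S)"
  shows "sos_mod V (boolean_ideal V) (mpoly_degree p) p"
proof -
  define c0 where "c0 = Poly_Mapping.lookup p 0"
  define c where "c k = Poly_Mapping.lookup p (Poly_Mapping.single k 1)" for k
  define a where "a k = sqrt (max 0 (- c k))" for k
  define b where "b k = sqrt (max 0 (c k))" for k
  define m where "m = c0 - (\<Sum>k\<in>V. max 0 (- c k))"
  define q where "q k = mconst (a k) + mconst (b k - a k) * mvar k" for k
  define qs where "qs = mconst (sqrt m) # map q (sorted_list_of_set V)"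

  have a2: "(a k)\<^sup>2 = max 0 (- c k)" and ba: "(b k)\<^sup>2 - (a k)\<^sup>2 = c k" for k
    by (auto simp: a_def b_def)

  have "(\<Sum>k\<in>{k \<in> V. c k < 0}. c k) = - (\<Sum>k\<in>V. max 0 (- c k))"
    unfolding sum.inter_filter[OF \<open>finite V\<close>] sum_negf[symmetric]
    by (intro sum.cong) auto
  then have "m = mpoly_eval p (indicator {k \<in> V. c k < 0})"
    using mpoly_eval_indicator_affine[OF assms(2), of "{k \<in> V. c k < 0}"] \<open>finite V\<close>
    by (simp add: m_def c0_def c_def)
  then have m0: "0 \<le> m" using nonneg[of "{k \<in> V. c k < 0}"] by auto

  have "(mconst (sqrt m))\<^sup>2 = mconst m"
    using m0 by (simp add: power2_eq_square flip: mconst_mult)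
  then have "(\<Sum>r\<leftarrow>qs. r\<^sup>2) = mconst m + (\<Sum>k\<in>V. (q k)\<^sup>2)"
    using sum_list_distinct_conv_sum_set[of "sorted_list_of_set V" "\<lambda>k. (q k)\<^sup>2"] \<open>finite V\<close>
    by (simp add: qs_def o_def)
  moreover have "p = mconst c0 + (\<Sum>k\<in>V. mconst (c k) * mvar k)"
    using mpoly_affine_form[OF assms(1-3)] by (simp add: c0_def c_def)
  moreover have "mconst c0 = mconst m + (\<Sum>k\<in>V. mconst ((a k)\<^sup>2))"
    by (simp add: m_def a2 mconst_diff mconst_sum)
  ultimately have "p - (\<Sum>r\<leftarrow>qs. r\<^sup>2)
      = (\<Sum>k\<in>V. (mconst ((a k)\<^sup>2) + mconst ((b k)\<^sup>2 - (a k)\<^sup>2) * mvar k) - (q k)\<^sup>2)"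
    unfolding ba by (simp add: sum.distrib sum_subtractf)
  also have "\<dots> \<in> boolean_ideal V"
    unfolding q_def by (intro boolean_ideal_sum affine_square_boolean_ideal)
  finally have "p - (\<Sum>r\<leftarrow>qs. r\<^sup>2) \<in> boolean_ideal V" .
  moreover have "r \<in> mpolys V \<and> mpoly_degree r \<le> mpoly_degree p" if "r \<in> set qs" for r
  proof -
    have "r = mconst (sqrt m) \<or> (\<exists>k\<in>V. r = q k)"
      using that \<open>finite V\<close> by (auto simp: qs_def)
    then show ?thesis
    proof
      assume r: "r = mconst (sqrt m)"
      have "mpoly_degree r \<le> mpoly_degree p"
        by (auto simp: r mpoly_degree_le_iff mconst_def split: if_splits)
      then show ?thesis using r mconst_in_mpolys by simp
    next
      assume "\<exists>k\<in>V. r = q k"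
      then obtain k where k: "k \<in> V" "r = q k" by blast
      have "1 \<le> mpoly_degree p" if "b k - a k \<noteq> 0"
      proof -
        have "c k \<noteq> 0" using that by (auto simp: a_def b_def)
        then have "Poly_Mapping.single k 1 \<in> Poly_Mapping.keys p"
          by (simp add: c_def in_keys_iff)
        then have "monom_degree (Poly_Mapping.single k 1) \<le> mpoly_degree p"
          using mpoly_degree_le_iff by blast
        then show ?thesis by (simp only: monom_degree_single)
      qed
      then have "mpoly_degree (q k) \<le> mpoly_degree p"
        unfolding q_def by (rule mpoly_degree_affine_le)
      then show ?thesis
        using k by (simp add: q_def mpolys_add mpolys_mult mconst_in_mpolys mvar_in_mpolys)
    qed
  qed
  ultimately show ?thesis unfolding sos_mod_def by blast
qed

section \<open>Partial derivatives of multilinear polynomials\<close>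

lemma lookup_mpoly_partial:
  "Poly_Mapping.lookup (mpoly_partial i p) m
    = real (Poly_Mapping.lookup m i + 1) * Poly_Mapping.lookup p (m + Poly_Mapping.single i 1)"
proof -
  let ?e = "Poly_Mapping.single i (1::nat)"
  have eq: "m' - ?e = m \<longleftrightarrow> m' = m + ?e" if "Poly_Mapping.lookup m' i \<noteq> 0" for m'
  proof
    assume "m' - ?e = m"
    then show "m' = m + ?e"
      using that by (intro poly_mapping_eqI) (auto simp: lookup_add lookup_minus lookup_single when_def)
  qed simp
  have "Poly_Mapping.lookup (mpoly_partial i p) m = (\<Sum>m'\<in>Poly_Mapping.keys p.
      if m' = m + ?e then Poly_Mapping.lookup p m' * real (Poly_Mapping.lookup m' i) else 0)"
    unfolding mpoly_partial_def lookup_sum lookup_single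
  proof (intro sum.cong refl)
    fix m'
    show "(Poly_Mapping.lookup p m' * real (Poly_Mapping.lookup m' i) when m' - ?e = m)
        = (if m' = m + ?e then Poly_Mapping.lookup p m' * real (Poly_Mapping.lookup m' i) else 0)"
      by (cases "Poly_Mapping.lookup m' i = 0") (auto simp: eq when_def simp del: One_nat_def)
  qed
  then show ?thesis
    by (auto simp: lookup_add in_keys_iff)
qed

lemma keys_mpoly_partial:
  "m \<in> Poly_Mapping.keys (mpoly_partial i p)
    \<longleftrightarrow> m + Poly_Mapping.single i 1 \<in> Poly_Mapping.keys p"
  by (simp add: in_keys_iff lookup_mpoly_partial del: of_nat_Suc of_nat_add)

lemma keys_add_single_1:
  fixes m :: monom
  shows "Poly_Mapping.keys (m + Poly_Mapping.single i 1) = insert i (Poly_Mapping.keys m)"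
  by (auto simp: in_keys_iff lookup_add lookup_single when_def split: if_splits)

lemma monom_degree_mpoly_partial:
  assumes "m \<in> Poly_Mapping.keys (mpoly_partial i p)"
  shows "Suc (monom_degree m) \<le> mpoly_degree p"
  using assms mpoly_degree_le_iff[of p "mpoly_degree p"] monom_degree_add_single[of m i 1]
  by (auto simp: keys_mpoly_partial)

lemma multilinear_partial:
  assumes "multilinear_poly p"
  shows "multilinear_poly (mpoly_partial i p)"
  unfolding multilinear_poly_def keys_mpoly_partial
proof (intro ballI allI)
  fix m k assume "m \<in> Poly_Mapping.keys (mpoly_partial i p)"
  then have "Poly_Mapping.lookup (m + Poly_Mapping.single i 1) k \<le> 1"
    using assms by (simp only: multilinear_poly_def keys_mpoly_partial)
  then show "Poly_Mapping.lookup m k \<le> 1" by (simp add: lookup_add)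
qed

lemma lookup_eq_0_if_mpoly_partial:
  assumes "multilinear_poly p" "m \<in> Poly_Mapping.keys (mpoly_partial i p)"
  shows "Poly_Mapping.lookup m i = 0"
proof -
  have "Poly_Mapping.lookup (m + Poly_Mapping.single i 1) i \<le> 1"
    using assms by (simp add: multilinear_poly_def keys_mpoly_partial)
  then show ?thesis by (simp add: lookup_add)
qed

lemma partial_in_mpolys:
  assumes "multilinear_poly p" "p \<in> mpolys V"
  shows "mpoly_partial i p \<in> mpolys (V - {i})"
  unfolding mpolys_def
proof (intro CollectI ballI)
  fix m assume m: "m \<in> Poly_Mapping.keys (mpoly_partial i p)"
  then have "insert i (Poly_Mapping.keys m) \<subseteq> V"
    using assms(2) keys_add_single_1[of m i] by (auto simp: mpolys_def keys_mpoly_partial)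
  then show "Poly_Mapping.keys m \<subseteq> V - {i}"
    using lookup_eq_0_if_mpoly_partial[OF assms(1) m] by (auto simp: in_keys_iff)
qed

text \<open>
  A multilinear polynomial is affine in \<open>x\<^sub>i\<close>, so its derivative is its difference quotient over
  the step from 0 to 1. On coefficients: the monomials that contribute at \<open>S \<union> {i}\<close> but not at
  \<open>S\<close> are those containing \<open>x\<^sub>i\<close>, and removing \<open>x\<^sub>i\<close> from them gives the monomials of the
  derivative.
\<close>

lemma mpoly_eval_partial:
  assumes "multilinear_poly p" "i \<notin> S"
  shows "mpoly_eval (mpoly_partial i p) (indicator S)
    = mpoly_eval p (indicator (insert i S)) - mpoly_eval p (indicator S)"
proof -
  let ?e = "Poly_Mapping.single i (1::nat)"
  let ?K = "\<lambda>S. {m \<in> Poly_Mapping.keys p. Poly_Mapping.keys m \<subseteq> S}"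
  let ?D = "{m \<in> Poly_Mapping.keys (mpoly_partial i p). Poly_Mapping.keys m \<subseteq> S}"
  have cancel: "m - ?e + ?e = m" if "m \<in> ?K (insert i S) - ?K S" for m
  proof -
    have "Poly_Mapping.lookup m i \<noteq> 0"
      using that by (auto simp: in_keys_iff)
    then show ?thesis
      by (intro poly_mapping_eqI) (auto simp: lookup_add lookup_minus lookup_single when_def)
  qed
  have "(\<Sum>m\<in>?D. Poly_Mapping.lookup (mpoly_partial i p) m)
      = (\<Sum>m\<in>?K (insert i S) - ?K S. Poly_Mapping.lookup p m)"
  proof (rule sum.reindex_bij_witness[where i = "\<lambda>m. m - ?e" and j = "\<lambda>m. m + ?e"])
    fix m assume m: "m \<in> ?D"
    show "m + ?e - ?e = m" by simp
    show "m + ?e \<in> ?K (insert i S) - ?K S"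
      using m assms(2) keys_add_single_1[of m i] by (auto simp: keys_mpoly_partial)
    have "Poly_Mapping.lookup m i = 0"
      using m lookup_eq_0_if_mpoly_partial[OF assms(1)] by blast
    then show "Poly_Mapping.lookup p (m + ?e) = Poly_Mapping.lookup (mpoly_partial i p) m"
      by (simp add: lookup_mpoly_partial)
  next
    fix m assume m: "m \<in> ?K (insert i S) - ?K S"
    show "m - ?e + ?e = m" using cancel[OF m] .
    have key: "m - ?e \<in> Poly_Mapping.keys (mpoly_partial i p)"
      using m cancel[OF m] by (simp add: keys_mpoly_partial)
    have "insert i (Poly_Mapping.keys (m - ?e)) \<subseteq> insert i S"
      using m cancel[OF m] keys_add_single_1[of "m - ?e" i] by simp
    then show "m - ?e \<in> ?D"
      using key lookup_eq_0_if_mpoly_partial[OF assms(1) key] by (auto simp: in_keys_iff)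
  qed
  also have "\<dots> = sum (Poly_Mapping.lookup p) (?K (insert i S)) - sum (Poly_Mapping.lookup p) (?K S)"
    by (rule sum_diff) auto
  finally show ?thesis by (simp add: mpoly_eval_indicator)
qed

lemma mpoly_eval_uminus: "mpoly_eval (- p) x = - mpoly_eval p x"
  by (simp add: mpoly_eval_def sum_negf)

lemma mpoly_degree_uminus: "mpoly_degree (- p) = mpoly_degree p"
  by (simp add: mpoly_degree_def)

section \<open>Second derivatives of the multilinear extension\<close>

lemma monom_degree_second_partial:
  assumes "m \<in> Poly_Mapping.keys (mpoly_partial i (mpoly_partial j p))"
  shows "monom_degree m + 2 \<le> mpoly_degree p"
  using assms monom_degree_mpoly_partial[of "m + Poly_Mapping.single i 1" j p]
    monom_degree_add_single[of m i 1]
  by (simp add: keys_mpoly_partial)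

lemma second_partial_mle_in_mpolys:
  "mpoly_partial i (mpoly_partial j (mle n f)) \<in> mpolys ({1..n} - {i, j})"
proof -
  have "{1..n} - {i, j} = {1..n} - {j} - {i}" by blast
  then show ?thesis
    using is_mle_mle[of n f] by (simp add: is_mle_def partial_in_mpolys multilinear_partial)
qed

lemma second_partial_mle_nonpos_if_submodular:
  assumes "submodular n f" "i \<in> {1..n}" "j \<in> {1..n}" "i \<noteq> j" "S \<subseteq> {1..n} - {i, j}"
  shows "mpoly_eval (mpoly_partial i (mpoly_partial j (mle n f))) (indicator S) \<le> 0"
proof -
  let ?F = "mle n f"
  have ml: "multilinear_poly ?F" and ev: "\<And>T. T \<subseteq> {1..n} \<Longrightarrow> mpoly_eval ?F (indicator T) = f T"
    using is_mle_mle[of n f] by (auto simp: is_mle_def)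
  have ij: "i \<notin> S" "j \<notin> S" "j \<notin> insert i S" using assms(4,5) by auto
  have sub: "S \<subseteq> {1..n}" "insert i S \<subseteq> {1..n}" "insert j S \<subseteq> {1..n}"
      "insert j (insert i S) \<subseteq> {1..n}"
    using assms by auto
  have "mpoly_eval (mpoly_partial i (mpoly_partial j ?F)) (indicator S)
      = (f (insert j (insert i S)) - f (insert i S)) - (f (insert j S) - f S)"
    using ij sub by (simp add: mpoly_eval_partial multilinear_partial ml ev)
  moreover have "f (insert i S) + f (insert j S) \<ge> f (insert j (insert i S)) + f S"
  proof -
    have "insert i S \<union> insert j S = insert j (insert i S)" "insert i S \<inter> insert j S = S"
      using ij assms(4) by auto
    then show ?thesis
      using assms(1) sub unfolding submodular_def by metis
  qed
  ultimately show ?thesis by linarith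
qed

lemma sos_mod_mono: "sos_mod V I s p \<Longrightarrow> s \<le> t \<Longrightarrow> sos_mod V I t p"
  unfolding sos_mod_def by (meson order_trans)

lemma sos_submodular_if_degree_le_3:
  assumes "submodular n f" "set_fun_degree n f \<le> t + 2" "t \<le> 1"
  shows "sos_submodular n t f"
  unfolding sos_submodular_def
proof (intro ballI impI)
  fix i j assume ij: "i \<in> {1..n}" "j \<in> {1..n}" "i \<noteq> j"
  let ?G = "mpoly_partial i (mpoly_partial j (mle n f))"
  have deg: "mpoly_degree (- ?G) \<le> t"
    unfolding mpoly_degree_uminus mpoly_degree_le_iff
    using monom_degree_second_partial[of _ i j "mle n f"] assms(2)
    by (fastforce simp: set_fun_degree_def)
  have "sos_mod ({1..n} - {i, j}) (boolean_ideal ({1..n} - {i, j})) (mpoly_degree (- ?G)) (- ?G)"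
  proof (rule sos_mod_boolean_affine_if_nonneg)
    show "- ?G \<in> mpolys ({1..n} - {i, j})"
      by (rule mpolys_uminus[OF second_partial_mle_in_mpolys])
    show "mpoly_degree (- ?G) \<le> 1" using deg assms(3) by simp
    show "0 \<le> mpoly_eval (- ?G) (indicator S)" if "S \<subseteq> {1..n} - {i, j}" for S
      using second_partial_mle_nonpos_if_submodular[OF assms(1) ij that]
      by (simp add: mpoly_eval_uminus)
  qed simp
  then show "sos_mod ({1..n} - {i, j}) (boolean_ideal ({1..n} - {i, j})) t (- ?G)"
    using deg by (rule sos_mod_mono)
qed

text \<open>Here all mixed second derivatives vanish, and the empty sum of squares represents them.\<close>

lemma sos_submodular_if_degree_le_1:
  assumes "set_fun_degree n f \<le> 1"
  shows "sos_submodular n 0 f"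
proof -
  have "mpoly_partial i (mpoly_partial j (mle n f)) = 0" for i j
    using monom_degree_second_partial[of _ i j "mle n f"] assms
    by (fastforce simp: set_fun_degree_def simp flip: keys_eq_empty)
  then show ?thesis
    unfolding sos_submodular_def sos_mod_def
    by (auto intro!: exI[of _ "[]"] simp: boolean_ideal_0)
qed

theorem proposition9:
  fixes n :: nat and f :: "nat set \<Rightarrow> real"
  shows "(set_fun_degree n f = 0 \<or> set_fun_degree n f = 1 \<longrightarrow> sos_submodular n 0 f) \<and>
         (submodular n f \<and> set_fun_degree n f = 2 \<longrightarrow> sos_submodular n 0 f) \<and>
         (submodular n f \<and> set_fun_degree n f = 3 \<longrightarrow> sos_submodular n 1 f)"
  using sos_submodular_if_degree_le_1[of n f] sos_submodular_if_degree_le_3[of n f 0]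
    sos_submodular_if_degree_le_3[of n f 1]
  by auto

end
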